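(* Let $F$ be a WT equation of an embedded algebroid surface $\mathcal S$ with $\overline F=Z^n$. Assume $\Delta(F)$ is a quadrant, and let $\mathcal S^{(1)}$ be a quadratic transform of $\mathcal S$ whose multiplicity is still $n$. If $F^{(1)}$ is a local WT equation of $\mathcal S^{(1)}$ (the equation of the blow-up in the chosen direction), then $\Delta(F^{(1)})$ is also a quadrant.
   Context: $K$ is an algebraically closed field of characteristic $0$ and $\nu$ is the usual order function on power series. An embedded algebroid surface of multiplicity $n>1$ is $\mathcal S=\mathrm{Spec}(K[[X,Y,Z]]/(F))$ with $\nu(F)=n$; $F$ is called an equation of $\mathcal S$ and $\overline F$ is its initial form. A Weierstrass-Tchirnhausen (WT) equation is $F=Z^n+\sum_{k=0}^{n-2}a_k(X,Y)Z^k$ with $a_k=\sum_{i,j} a_{ijk}X^iY^j\in K[[X,Y]]$, $\nu(a_k)\ge n-k$. The Hironaka polygon $\Delta(F)$ is the convex hull of $\bigcup_{a_{ijk}\ne0}\left[\left(\frac{i}{n-k},\frac{j}{n-k}\right)+\mathbb Q_{\ge0}^2\right]$ (over the monomials other than $Z^n$). It is a quadrant if it has only one vertex; the empty set is also considered a quadrant. Since $\overline F=Z^n$, the possible directions of a quadratic transformation are $(a:b:0)$. In the direction $(1:\alpha:0)$, $\alpha\in K$, it is $X\mapsto X$, $Y\mapsto X(Y+\alpha)$, $Z\mapsto XZ$ and $F^{(1)}$ is the image of $F$ divided by $X^n$; in the direction $(0:1:0)$ it is $X\mapsto XY$, $Y\mapsto Y$, $Z\mapsto YZ$ and $F^{(1)}$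 is the image of $F$ divided by $Y^n$. *)

theory Defs
  imports
    "HOL-Analysis.Analysis"
    "HOL-Computational_Algebra.Computational_Algebra"
begin

text \<open>
  \<open>K[[X,Y]]\<close> is the iterated ring \<open>K[[X]][[Y]]\<close>, and \<open>K[[X,Y,Z]]\<close> is \<open>K[[X]][[Y]][[Z]]\<close>:
  the outermost variable is the last one.
\<close>

type_synonym 'a series2 = "'a fps fps"
type_synonym 'a series3 = "'a fps fps fps"

definition coeff3 :: "'a::zero series3 \<Rightarrow> nat \<Rightarrow> nat \<Rightarrow> nat \<Rightarrow> 'a" where
  "coeff3 F i j k = fps_nth (fps_nth (fps_nth F k) j) i"

definition mk_series3 :: "(nat \<Rightarrow> nat \<Rightarrow> nat \<Rightarrow> 'a) \<Rightarrow> 'a series3" where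
  "mk_series3 f = Abs_fps (\<lambda>k. Abs_fps (\<lambda>j. Abs_fps (\<lambda>i. f i j k)))"

definition varX :: "'a::comm_ring_1 series3" where
  "varX = fps_const (fps_const fps_X)"

definition varY :: "'a::comm_ring_1 series3" where
  "varY = fps_const fps_X"

definition varZ :: "'a::comm_ring_1 series3" where
  "varZ = fps_X"

definition const3 :: "'a::comm_ring_1 \<Rightarrow> 'a series3" where
  "const3 \<alpha> = fps_const (fps_const (fps_const \<alpha>))"

text \<open>The usual order function; the zero series has order \<open>\<infinity>\<close>, being an infimum over the empty set.\<close>

definition ord3 :: "'a::zero series3 \<Rightarrow> enat" where
  "ord3 F = Inf {enat (i + j + k) | i j k. coeff3 F i j k \<noteq> 0}"

definition initial_form :: "'a::zero series3 \<Rightarrow> 'a series3" where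
  "initial_form F = mk_series3 (\<lambda>i j k. if enat (i + j + k) = ord3 F then coeff3 F i j k else 0)"

definition WT_equation :: "nat \<Rightarrow> 'a::comm_ring_1 series3 \<Rightarrow> bool" where
  "WT_equation n F \<longleftrightarrow> n > 1 \<and>
     (\<exists>a :: nat \<Rightarrow> 'a series2.
        F = varZ ^ n + (\<Sum>k = 0..n - 2. fps_const (a k) * varZ ^ k) \<and>
        (\<forall>k \<le> n - 2. ord3 (fps_const (a k)) \<ge> enat (n - k)))"

text \<open>
  The polygon is taken in the real plane. The division is meaningful for a WT equation, where all
  monomials other than \<open>Z^n\<close> have \<open>k \<le> n - 2\<close>.
\<close>

definition hironaka_polygon :: "nat \<Rightarrow> 'a::zero series3 \<Rightarrow> (real \<times> real) set" where
  "hironaka_polygon n F = convex hull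
     (\<Union>(i, j, k) \<in> {(i, j, k). coeff3 F i j k \<noteq> 0 \<and> (i, j, k) \<noteq> (0, 0, n)}.
        {(real i / (real n - real k) + s, real j / (real n - real k) + t) | s t.
           s \<in> \<rat> \<and> s \<ge> 0 \<and> t \<in> \<rat> \<and> t \<ge> 0})"

definition is_quadrant :: "(real \<times> real) set \<Rightarrow> bool" where
  "is_quadrant D \<longleftrightarrow> D = {} \<or> (\<exists>!v. v extreme_point_of D)"

text \<open>
  Substitution \<open>F(P, Q, R)\<close>, for \<open>P\<close>, \<open>Q\<close>, \<open>R\<close> of positive order. Then \<open>P^i Q^j R^k\<close> has order at
  least \<open>i + j + k\<close>, so only exponents up to the degree \<open>d\<close> of a monomial contribute to its
  coefficient, and truncating the sum there loses nothing.
\<close>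

definition subst3 :: "'a::comm_ring_1 series3 \<Rightarrow> 'a series3 \<Rightarrow> 'a series3 \<Rightarrow> 'a series3 \<Rightarrow> 'a series3" where
  "subst3 F P Q R = mk_series3 (\<lambda>a b c. let d = a + b + c in
     \<Sum>i\<le>d. \<Sum>j\<le>d. \<Sum>k\<le>d. coeff3 F i j k * coeff3 (P ^ i * Q ^ j * R ^ k) a b c)"

text \<open>
  \<open>F1\<close> is the image of \<open>F\<close> divided by \<open>X^n\<close> (direction \<open>(1:\<alpha>:0)\<close>) or by \<open>Y^n\<close> (direction
  \<open>(0:1:0)\<close>). These are all the possible directions when the initial form of \<open>F\<close> is \<open>Z^n\<close>.
\<close>

definition quadratic_transform :: "nat \<Rightarrow> 'a::comm_ring_1 series3 \<Rightarrow> 'a series3 \<Rightarrow> bool" where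
  "quadratic_transform n F F1 \<longleftrightarrow>
     (\<exists>\<alpha>. varX ^ n * F1 = subst3 F varX (varX * (varY + const3 \<alpha>)) (varX * varZ)) \<or>
     varY ^ n * F1 = subst3 F (varX * varY) varY (varY * varZ)"

end

theory Submission
  imports Defs
begin

text \<open>
  Attach to a monomial \<open>X^i Y^j Z^k\<close> other than \<open>Z^n\<close> the point \<open>(i/(n-k), j/(n-k))\<close>. The polygon is a
  nonempty quadrant exactly when one of these points is below all the others in both coordinates
  (\<open>is_quadrant_hironaka_polygon_iff\<close>): such a point is the only vertex, and conversely the
  lexicographically least point and the least point for the opposite lexicographic order are both
  vertices, so if they coincide they minimise both coordinates at once.

  In terms of the points \<open>(x, y)\<close>, the directions \<open>(1:0:0)\<close> and \<open>(0:1:0)\<close> map monomials to monomials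
  and act by \<open>(x, y) \<mapsto> (x + y - 1, y)\<close> and \<open>(x, y) \<mapsto> (x, x + y - 1)\<close>. Both maps are monotone,
  so they preserve the existence of a least point. In a direction \<open>(1:\<alpha>:0)\<close> with \<open>\<alpha> \<noteq> 0\<close>, the
  factor \<open>Y^j\<close> becomes \<open>X^j (Y + \<alpha>)^j\<close>, which contains \<open>X^j\<close> with the coefficient \<open>\<alpha>^j\<close>; hence
  a least point \<open>(x, y)\<close> gives the candidate \<open>(x + y - 1, 0)\<close>, which is below every new point.

  It remains to see that the candidate is not lost by cancellation. A monomial
  contributing to the same coefficient has the same \<open>k\<close> and the same \<open>i + j\<close>. Minimality bounds its
  exponents below by \<open>i\<close> and \<open>j\<close>, so it is the vertex monomial itself.
\<close>

section \<open>Quadrants spanned by a set of points\<close>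

text \<open>
  The points that are lexicographically at least \<open>p\<close> form a convex set, and \<open>p\<close> is extreme in it: the
  linear coordinates of \<open>p\<close> are averages of those of the endpoints of a segment through \<open>p\<close>, which
  forces equality first in \<open>f\<close> and then in \<open>g\<close>. Two arbitrary functionals, rather than the two
  projections, let the lemma serve both lexicographic orders of the plane.
\<close>

lemma extreme_point_of_lex_min:
  fixes f g :: "'v::real_vector \<Rightarrow> real"
  assumes "linear f" "linear g" "\<And>u v. f u = f v \<Longrightarrow> g u = g v \<Longrightarrow> u = v"
    and "p \<in> S" "\<And>q. q \<in> S \<Longrightarrow> f p < f q \<or> f p = f q \<and> g p \<le> g q"
  shows "p extreme_point_of (convex hull S)"
proof -
  define L where "L = {q. f p < f q \<or> f p = f q \<and> g p \<le> g q}"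
  have "convex L"
  proof (rule convexI)
    fix x y and u v :: real
    assume xy: "x \<in> L" "y \<in> L" and uv: "0 \<le> u" "0 \<le> v" "u + v = 1"
    have fx: "f p \<le> f x" "f p \<le> f y" using xy by (auto simp: L_def)
    have lin: "h (u *\<^sub>R x + v *\<^sub>R y) - h p = u * (h x - h p) + v * (h y - h p)" if "linear h" for h
    proof -
      have "h (u *\<^sub>R x + v *\<^sub>R y) - h p = u * h x + v * h y - (u + v) * h p"
        using that uv(3) by (simp add: linear_add linear_scale)
      then show ?thesis by (simp only: algebra_simps)
    qed
    note F = lin[OF assms(1)] and G = lin[OF assms(2)]
    have nn: "0 \<le> u * (f x - f p)" "0 \<le> v * (f y - f p)"
      using fx uv by (simp_all add: mult_nonneg_nonneg)
    show "u *\<^sub>R x + v *\<^sub>R y \<in> L"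
    proof (cases "u * (f x - f p) = 0 \<and> v * (f y - f p) = 0")
      case True
      have "u = 0 \<or> g p \<le> g x" "v = 0 \<or> g p \<le> g y"
        using True xy unfolding L_def mem_Collect_eq by (metis eq_iff_diff_eq_0 less_irrefl mult_eq_0_iff)+
      then have "0 \<le> u * (g x - g p)" "0 \<le> v * (g y - g p)"
        using uv by (auto intro: mult_nonneg_nonneg)
      then have "f (u *\<^sub>R x + v *\<^sub>R y) = f p" "g p \<le> g (u *\<^sub>R x + v *\<^sub>R y)"
        using True F G by linarith+
      then show ?thesis by (simp add: L_def)
    next
      case False
      then have "f p < f (u *\<^sub>R x + v *\<^sub>R y)" using nn F by linarith
      then show ?thesis by (simp add: L_def)
    qed
  qed
  then have sub: "convex hull S \<subseteq> L"
    using assms(5) by (intro hull_minimal) (auto simp: L_def)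
  have "p \<notin> open_segment a b" if ab: "a \<in> L" "b \<in> L" for a b
  proof
    assume "p \<in> open_segment a b"
    then obtain u where u: "a \<noteq> b" "0 < u" "u < 1" "p = (1 - u) *\<^sub>R a + u *\<^sub>R b"
      unfolding in_segment by blast
    have eq: "h a = h p \<and> h b = h p" if h: "linear h" "h p \<le> h a" "h p \<le> h b"
      for h :: "'v \<Rightarrow> real"
    proof -
      have "h p = (1 - u) * h a + u * h b"
        using h(1) by (subst u(4)) (simp add: linear_add linear_scale)
      then have "(1 - u) * (h a - h p) + u * (h b - h p) = 0" by (simp add: algebra_simps)
      moreover have "0 \<le> (1 - u) * (h a - h p)" "0 \<le> u * (h b - h p)"
        using u(2,3) h(2,3) by (simp_all add: mult_nonneg_nonneg)
      ultimately have "(1 - u) * (h a - h p) = 0" "u * (h b - h p) = 0" by linarith+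
      then show ?thesis using u(2,3) by simp
    qed
    have f: "f a = f p \<and> f b = f p"
      using eq[OF assms(1)] ab by (auto simp: L_def)
    moreover have "g a = g p \<and> g b = g p"
      using eq[OF assms(2)] ab f by (auto simp: L_def)
    ultimately show False using assms(3)[of a b] u(1) by simp
  qed
  then show ?thesis
    using hull_inc[OF assms(4)] sub unfolding extreme_point_of_def by blast
qed

definition rational_quadrants :: "(real \<times> real) set \<Rightarrow> (real \<times> real) set" where
  "rational_quadrants P =
     (\<Union>p\<in>P. {(fst p + s, snd p + t) | s t. s \<in> \<rat> \<and> s \<ge> 0 \<and> t \<in> \<rat> \<and> t \<ge> 0})"

lemma in_rational_quadrants:
  "p \<in> P \<Longrightarrow> s \<in> \<rat> \<Longrightarrow> s \<ge> 0 \<Longrightarrow> t \<in> \<rat> \<Longrightarrow> t \<ge> 0 \<Longrightarrow> (fst p + s, snd p + t) \<in> rational_quadrants P"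
  unfolding rational_quadrants_def by blast

lemma subset_rational_quadrants: "P \<subseteq> rational_quadrants P"
  using in_rational_quadrants[of _ P 0 0] by auto

text \<open>
  Convexity restores the irrational points: a large rectangle with corner \<open>p\<close> and integral side length
  has its four corners in the set, and interpolation along first the horizontal and then the
  vertical sides fills it.
\<close>

lemma convex_hull_rational_quadrants:
  assumes "p \<in> P" "\<And>q. q \<in> P \<Longrightarrow> fst p \<le> fst q \<and> snd p \<le> snd q"
  shows "convex hull (rational_quadrants P) = {fst p..} \<times> {snd p..}"
proof
  have "rational_quadrants P \<subseteq> {fst p..} \<times> {snd p..}"
    unfolding rational_quadrants_def by (auto dest!: assms(2))
  then show "convex hull (rational_quadrants P) \<subseteq> {fst p..} \<times> {snd p..}"
    by (intro hull_minimal convex_Times) auto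
next
  show "{fst p..} \<times> {snd p..} \<subseteq> convex hull (rational_quadrants P)"
  proof
    fix q assume "q \<in> {fst p..} \<times> {snd p..}"
    then obtain u v where q: "q = (fst p + u, snd p + v)" and uv: "u \<ge> 0" "v \<ge> 0"
      using that[of "fst q - fst p" "snd q - snd p"] by auto
    obtain N :: nat where N: "real N > max u v" using reals_Archimedean2 by blast
    have N0: "real N > 0" using N uv by auto
    let ?H = "convex hull (rational_quadrants P)"
    have cH: "convex ?H" by simp
    have corner: "(fst p + s, snd p + t) \<in> ?H" if "s \<in> {0, real N}" "t \<in> {0, real N}" for s t
      using that by (intro hull_inc in_rational_quadrants assms) auto
    define a b where "a = u / N" and "b = v / N"
    have ab: "0 \<le> a" "a \<le> 1" "0 \<le> b" "b \<le> 1" "a * N = u" "b * N = v"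
      using N N0 uv by (auto simp: a_def b_def)
    have edge: "(fst p + u, snd p + t) \<in> ?H" if "t \<in> {0, real N}" for t
    proof -
      have "(1 - a) *\<^sub>R (fst p + 0, snd p + t) + a *\<^sub>R (fst p + N, snd p + t) \<in> ?H"
        by (rule convexD_alt[OF cH corner[OF _ that] corner[OF _ that] ab(1,2)]) auto
      moreover have "(1 - a) *\<^sub>R (fst p + 0, snd p + t) + a *\<^sub>R (fst p + N, snd p + t) =
          (fst p + a * N, snd p + t)"
        by (simp add: algebra_simps)
      ultimately show ?thesis by (simp only: ab)
    qed
    have "(1 - b) *\<^sub>R (fst p + u, snd p + 0) + b *\<^sub>R (fst p + u, snd p + N) \<in> ?H"
      by (rule convexD_alt[OF cH edge edge ab(3,4)]) auto
    moreover have "(1 - b) *\<^sub>R (fst p + u, snd p + 0) + b *\<^sub>R (fst p + u, snd p + N) =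
        (fst p + u, snd p + b * N)"
      by (simp add: algebra_simps)
    ultimately show "q \<in> ?H" by (simp only: ab q)
  qed
qed

lemma extreme_point_of_closed_quadrant:
  fixes x y :: real
  shows "v extreme_point_of ({x..} \<times> {y..}) \<longleftrightarrow> v = (x, y)"
proof
  assume v: "v extreme_point_of ({x..} \<times> {y..})"
  obtain a b where ab: "v = (a, b)" by (cases v)
  \<comment> \<open>The reflection of the corner in \<open>v\<close> stays in the quadrant, so \<open>v\<close> is a midpoint.\<close>
  have vin: "x \<le> a" "y \<le> b" using v by (auto simp: extreme_point_of_def ab)
  define w where "w = (2 * a - x, 2 * b - y)"
  have "midpoint (x, y) w = v" by (simp add: w_def ab midpoint_def)
  moreover have "(x, y) \<in> {x..} \<times> {y..}" "w \<in> {x..} \<times> {y..}"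
    using vin by (simp_all add: w_def)
  ultimately have "\<not> midpoint (x, y) w \<in> open_segment (x, y) w"
    using v unfolding extreme_point_of_def by blast
  then have "(x, y) = w" unfolding midpoint_in_open_segment by blast
  then show "v = (x, y)" by (simp add: w_def ab)
next
  assume "v = (x, y)"
  moreover have "(x, y) extreme_point_of (convex hull ({x..} \<times> {y..}))"
  proof (rule extreme_point_of_lex_min[of fst snd])
    show "fst (x, y) < fst q \<or> fst (x, y) = fst q \<and> snd (x, y) \<le> snd q"
      if "q \<in> {x..} \<times> {y..}" for q
      using that by (cases q) auto
  qed (auto simp: linear_fst linear_snd prod_eq_iff)
  moreover have "convex hull ({x..} \<times> {y..}) = {x..} \<times> {y..}"
    by (intro hull_same convex_Times) auto
  ultimately show "v extreme_point_of ({x..} \<times> {y..})" by simp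
qed

lemma extreme_point_of_rational_quadrants:
  assumes fg: "(f, g) \<in> {(fst, snd), (snd, fst)}"
    and p: "p \<in> P" "\<And>q. q \<in> P \<Longrightarrow> f p < f q \<or> f p = f q \<and> g p \<le> g q"
  shows "p extreme_point_of (convex hull (rational_quadrants P))"
proof (rule extreme_point_of_lex_min[of f g])
  fix q assume "q \<in> rational_quadrants P"
  then obtain r s t where "r \<in> P" "s \<ge> 0" "t \<ge> 0" "q = (fst r + s, snd r + t)"
    unfolding rational_quadrants_def by blast
  then show "f p < f q \<or> f p = f q \<and> g p \<le> g q"
    using p(2)[of r] fg by auto
qed (use fg p(1) subset_rational_quadrants[of P] in
      \<open>auto simp: linear_fst linear_snd prod_eq_iff\<close>)

section \<open>Vertices of the Hironaka polygon\<close>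

definition other_monomials :: "nat \<Rightarrow> 'a::zero series3 \<Rightarrow> (nat \<times> nat \<times> nat) set" where
  "other_monomials n F = {(i, j, k). coeff3 F i j k \<noteq> 0 \<and> (i, j, k) \<noteq> (0, 0, n)}"

fun polygon_point :: "nat \<Rightarrow> nat \<times> nat \<times> nat \<Rightarrow> real \<times> real" where
  "polygon_point n (i, j, k) = (real i / (real n - real k), real j / (real n - real k))"

lemma hironaka_polygon_eq:
  "hironaka_polygon n F = convex hull (rational_quadrants (polygon_point n ` other_monomials n F))"
proof -
  have "rational_quadrants (polygon_point n ` other_monomials n F) =
     (\<Union>(i, j, k)\<in>other_monomials n F.
        {(real i / (real n - real k) + s, real j / (real n - real k) + t) | s t.
           s \<in> \<rat> \<and> s \<ge> 0 \<and> t \<in> \<rat> \<and> t \<ge> 0})"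
    unfolding rational_quadrants_def image_image by (rule SUP_cong[OF refl]) (clarsimp split: prod.split)
  then show ?thesis
    by (simp only: hironaka_polygon_def other_monomials_def)
qed

lemma lex_min_exists:
  fixes f g :: "'m \<Rightarrow> nat"
  assumes "M \<noteq> {}"
  obtains m where "m \<in> M" "\<And>q. q \<in> M \<Longrightarrow> f m < f q \<or> f m = f q \<and> g m \<le> g q"
proof -
  obtain a where a: "a \<in> M" "\<forall>q. q \<in> M \<longrightarrow> f a \<le> f q"
    using ex_has_least_nat[of "\<lambda>m. m \<in> M"] assms by blast
  obtain b where b: "b \<in> M \<and> f b = f a" "\<forall>q. q \<in> M \<and> f q = f a \<longrightarrow> g b \<le> g q"
    using ex_has_least_nat[of "\<lambda>m. m \<in> M \<and> f m = f a" a g] a by blast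
  show thesis using that[of b] a b by (metis le_neq_implies_less)
qed

text \<open>
  All denominators \<open>n - k\<close> divide \<open>n!\<close>. Clearing them makes the points integral, so that minima exist
  although there may be infinitely many monomials.
\<close>

lemma polygon_point_scaled:
  assumes "\<And>i j k. (i, j, k) \<in> M \<Longrightarrow> k < n"
  obtains u v :: "nat \<times> nat \<times> nat \<Rightarrow> nat" where
    "\<And>m. m \<in> M \<Longrightarrow> polygon_point n m = (real (u m) / fact n, real (v m) / fact n)"
proof -
  define u where "u = (\<lambda>(i, j::nat, k). i * (fact n div (n - k)))"
  define v where "v = (\<lambda>(i::nat, j, k). j * (fact n div (n - k)))"
  have "polygon_point n (i, j, k) = (real (u (i, j, k)) / fact n, real (v (i, j, k)) / fact n)"
    if "(i, j, k) \<in> M" for i j k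
  proof -
    have k: "k < n" using assms that by blast
    then have "(n - k) dvd fact n" by (intro dvd_fact) auto
    then have e: "fact n = real (n - k) * real (fact n div (n - k))"
      by (metis dvd_mult_div_cancel of_nat_fact of_nat_mult)
    have "real (fact n div (n - k)) \<noteq> 0" using e by (metis fact_nonzero mult_zero_right)
    then show ?thesis using k by (simp add: u_def v_def e of_nat_diff)
  qed
  then show thesis using that by (metis prod_cases3)
qed

lemma is_quadrant_hironaka_polygon_iff:
  fixes F :: "'a::zero series3"
  assumes "\<And>i j k. (i, j, k) \<in> other_monomials n F \<Longrightarrow> k < n"
  shows "is_quadrant (hironaka_polygon n F) \<longleftrightarrow> other_monomials n F = {} \<or>
     (\<exists>m\<in>other_monomials n F. \<forall>q\<in>other_monomials n F.
        fst (polygon_point n m) \<le> fst (polygon_point n q) \<and>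
        snd (polygon_point n m) \<le> snd (polygon_point n q))"
    (is "_ \<longleftrightarrow> ?M = {} \<or> ?R")
proof (cases "?M = {}")
  case True
  then show ?thesis
    by (simp add: hironaka_polygon_eq is_quadrant_def rational_quadrants_def)
next
  case False
  let ?P = "polygon_point n ` ?M"
  have "hironaka_polygon n F \<noteq> {}"
    using False subset_rational_quadrants[of ?P] by (auto simp: hironaka_polygon_eq)
  then have iff: "is_quadrant (hironaka_polygon n F) \<longleftrightarrow>
      (\<exists>!v. v extreme_point_of (convex hull (rational_quadrants ?P)))"
    by (auto simp: is_quadrant_def hironaka_polygon_eq)
  show ?thesis
  proof (intro iffI disjI2)
    obtain u v where uv: "\<And>m. m \<in> ?M \<Longrightarrow>
        polygon_point n m = (real (u m) / fact n, real (v m) / fact n)"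
      using polygon_point_scaled[of ?M n] assms by blast
    obtain a where a: "a \<in> ?M" "\<And>q. q \<in> ?M \<Longrightarrow> u a < u q \<or> u a = u q \<and> v a \<le> v q"
      using lex_min_exists[OF False] by blast
    obtain b where b: "b \<in> ?M" "\<And>q. q \<in> ?M \<Longrightarrow> v b < v q \<or> v b = v q \<and> u b \<le> u q"
      using lex_min_exists[OF False] by blast
    have "polygon_point n a extreme_point_of (convex hull (rational_quadrants ?P))"
    proof (rule extreme_point_of_rational_quadrants[of fst snd])
      fix q assume "q \<in> ?P"
      then obtain m where "m \<in> ?M" "q = polygon_point n m" by blast
      then show "fst (polygon_point n a) < fst q \<or>
          fst (polygon_point n a) = fst q \<and> snd (polygon_point n a) \<le> snd q"
        using a(2)[of m] by (auto simp: uv a(1) divide_strict_right_mono divide_right_mono)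
    qed (use a in auto)
    moreover have "polygon_point n b extreme_point_of (convex hull (rational_quadrants ?P))"
    proof (rule extreme_point_of_rational_quadrants[of snd fst])
      fix q assume "q \<in> ?P"
      then obtain m where "m \<in> ?M" "q = polygon_point n m" by blast
      then show "snd (polygon_point n b) < snd q \<or>
          snd (polygon_point n b) = snd q \<and> fst (polygon_point n b) \<le> fst q"
        using b(2)[of m] by (auto simp: uv b(1) divide_strict_right_mono divide_right_mono)
    qed (use b in auto)
    moreover assume "is_quadrant (hironaka_polygon n F)"
    ultimately have "polygon_point n a = polygon_point n b"
      unfolding iff by blast
    then have "v a = v b" by (simp add: uv a(1) b(1))
    then have "u a \<le> u q \<and> v a \<le> v q" if "q \<in> ?M" for q
      using a(2)[OF that] b(2)[OF that] by auto
    then show ?R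
      using a(1) by (intro bexI[of _ a]) (auto simp: uv divide_right_mono)
  next
    assume "?M = {} \<or> ?R"
    then obtain m where "m \<in> ?M" "\<And>q. q \<in> ?M \<Longrightarrow>
        fst (polygon_point n m) \<le> fst (polygon_point n q) \<and>
        snd (polygon_point n m) \<le> snd (polygon_point n q)" using False by blast
    then have "convex hull (rational_quadrants ?P) =
        {fst (polygon_point n m)..} \<times> {snd (polygon_point n m)..}"
      by (intro convex_hull_rational_quadrants) auto
    then show "is_quadrant (hironaka_polygon n F)"
      by (simp add: iff extreme_point_of_closed_quadrant)
  qed
qed

section \<open>Coefficients of a quadratic transform\<close>

lemma coeff3_subst3_eq_sum:
  "coeff3 (subst3 F P Q R) a b c =
     (\<Sum>(i, j, k)\<in>{..a + b + c} \<times> {..a + b + c} \<times> {..a + b + c}.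
        coeff3 F i j k * coeff3 (P ^ i * Q ^ j * R ^ k) a b c)"
  by (simp add: subst3_def mk_series3_def Let_def sum.cartesian_product coeff3_def[of "Abs_fps _"])

lemma coeff3_subst3_nonzero:
  assumes "coeff3 (subst3 F P Q R) a b c \<noteq> 0"
  obtains i j k where "coeff3 F i j k \<noteq> 0" "coeff3 (P ^ i * Q ^ j * R ^ k) a b c \<noteq> 0"
proof -
  obtain m where "(case m of (i, j, k) \<Rightarrow> coeff3 F i j k * coeff3 (P ^ i * Q ^ j * R ^ k) a b c) \<noteq> 0"
    using assms sum.not_neutral_contains_not_neutral unfolding coeff3_subst3_eq_sum by blast
  then show thesis using that[of "fst m" "fst (snd m)" "snd (snd m)"]
    by (metis (mono_tags, lifting) mult_not_zero split_def)
qed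

text \<open>
  This is how a coefficient of the transform is shown not to vanish: if no other monomial contributes,
  nothing can cancel.
\<close>

lemma coeff3_subst3_single:
  assumes "i \<le> a + b + c" "j \<le> a + b + c" "k \<le> a + b + c"
    and "\<And>i' j' k'. coeff3 F i' j' k' \<noteq> 0 \<Longrightarrow> coeff3 (P ^ i' * Q ^ j' * R ^ k') a b c \<noteq> 0 \<Longrightarrow>
      (i', j', k') = (i, j, k)"
  shows "coeff3 (subst3 F P Q R) a b c = coeff3 F i j k * coeff3 (P ^ i * Q ^ j * R ^ k) a b c"
proof -
  have "coeff3 (subst3 F P Q R) a b c = (\<Sum>(i, j, k)\<in>{(i, j, k)}.
        coeff3 F i j k * coeff3 (P ^ i * Q ^ j * R ^ k) a b c)"
    unfolding coeff3_subst3_eq_sum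
  proof (intro sum.mono_neutral_right ballI)
    fix m assume "m \<in> {..a + b + c} \<times> {..a + b + c} \<times> {..a + b + c} - {(i, j, k)}"
    then obtain i' j' k' where m: "m = (i', j', k')" "(i', j', k') \<noteq> (i, j, k)"
      by (cases m) auto
    then have "coeff3 F i' j' k' * coeff3 (P ^ i' * Q ^ j' * R ^ k') a b c = 0"
      using assms(4)[of i' j' k'] by (metis mult_zero_left mult_zero_right)
    then show "(case m of (i, j, k) \<Rightarrow>
        coeff3 F i j k * coeff3 (P ^ i * Q ^ j * R ^ k) a b c) = 0"
      by (simp only: m prod.case)
  qed (use assms(1-3) in auto)
  then show ?thesis by simp
qed

lemma fps_nth_linear_power_fps_const:
  fixes \<alpha> :: "'a::comm_ring_1"
  shows "fps_nth ((fps_X + fps_const (fps_const \<alpha>)) ^ j) b =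
    fps_const (fps_nth ((fps_X + fps_const \<alpha>) ^ j) b)"
proof (induction j arbitrary: b)
  case 0
  then show ?case by simp
next
  case (Suc j)
  then show ?case by (cases b) (simp_all add: distrib_right)
qed

lemma coeff3_product_direction_X:
  fixes \<alpha> :: "'a::comm_ring_1"
  shows "coeff3 (varX ^ i * (varX * (varY + const3 \<alpha>)) ^ j * (varX * varZ) ^ k) a b c =
    (if a = i + j + k \<and> c = k then fps_nth ((fps_X + fps_const \<alpha>) ^ j) b else 0)"
proof -
  have "varX ^ i * (varX * (varY + const3 \<alpha>)) ^ j * (varX * varZ) ^ k =
     fps_const (fps_const (fps_X ^ (i + j + k)) * (fps_X + fps_const (fps_const \<alpha>)) ^ j) * fps_X ^ k"
    by (simp add: varX_def varY_def varZ_def const3_def power_mult_distrib power_add mult_ac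
        flip: fps_const_power fps_const_mult)
  then show ?thesis
    by (simp add: coeff3_def fps_nth_linear_power_fps_const)
qed

lemma coeff3_product_direction_Y:
  "coeff3 ((varX * varY) ^ i * varY ^ j * (varY * varZ) ^ k :: 'a::comm_ring_1 series3) a b c =
    (if a = i \<and> b = i + j + k \<and> c = k then 1 else 0)"
proof -
  have "((varX * varY) ^ i * varY ^ j * (varY * varZ) ^ k :: 'a series3) =
     fps_const (fps_const (fps_X ^ i) * fps_X ^ (i + j + k)) * fps_X ^ k"
    by (simp add: varX_def varY_def varZ_def power_mult_distrib power_add mult_ac
        flip: fps_const_power fps_const_mult)
  then show ?thesis by (simp add: coeff3_def)
qed

lemma coeff3_varX_power_mult: "coeff3 (varX ^ n * G) (a + n) b c = coeff3 G a b c"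
  by (simp add: coeff3_def varX_def fps_X_power_mult_nth)

lemma coeff3_varY_power_mult: "coeff3 (varY ^ n * G) a (b + n) c = coeff3 G a b c"
  by (simp add: coeff3_def varY_def fps_X_power_mult_nth)

section \<open>Quadratic transforms of quadrants\<close>

lemma WT_equation_other_monomials_less:
  assumes "WT_equation n F" "(i, j, k) \<in> other_monomials n F"
  shows "k < n"
proof (rule ccontr)
  assume "\<not> k < n"
  from assms(1) obtain a where n: "n > 1"
    and F: "F = varZ ^ n + (\<Sum>k = 0..n - 2. fps_const (a k) * varZ ^ k)"
    unfolding WT_equation_def by blast
  have "fps_nth F k = (if k = n then 1 else 0)"
    using n \<open>\<not> k < n\<close> by (auto simp: F varZ_def fps_sum_nth intro!: sum.neutral)
  then show False
    using assms(2) by (auto simp: other_monomials_def coeff3_def split: if_splits)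
qed

lemma ord3_le: "coeff3 F i j k \<noteq> 0 \<Longrightarrow> ord3 F \<le> enat (i + j + k)"
  unfolding ord3_def by (rule Inf_lower) blast

text \<open>
  The common argument for all directions. The map \<open>\<tau>\<close> sends a monomial to the lower left corner of its
  image; it only has to hit an actual monomial of \<open>F1\<close> when started from a vertex, since elsewhere the
  corner may cancel.
\<close>

lemma is_quadrant_transfer:
  fixes F F1 :: "'a::zero series3" and \<tau> :: "nat \<times> nat \<times> nat \<Rightarrow> nat \<times> nat \<times> nat"
  assumes "\<And>i j k. (i, j, k) \<in> other_monomials n F \<Longrightarrow> k < n"
    and "\<And>i j k. (i, j, k) \<in> other_monomials n F1 \<Longrightarrow> k < n"
    and quad: "is_quadrant (hironaka_polygon n F)"
    and lower: "\<And>q. q \<in> other_monomials n F1 \<Longrightarrow> \<exists>m\<in>other_monomials n F.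
        fst (polygon_point n (\<tau> m)) \<le> fst (polygon_point n q) \<and>
        snd (polygon_point n (\<tau> m)) \<le> snd (polygon_point n q)"
    and mono: "\<And>m q. m \<in> other_monomials n F \<Longrightarrow> q \<in> other_monomials n F \<Longrightarrow>
        fst (polygon_point n m) \<le> fst (polygon_point n q) \<Longrightarrow>
        snd (polygon_point n m) \<le> snd (polygon_point n q) \<Longrightarrow>
        fst (polygon_point n (\<tau> m)) \<le> fst (polygon_point n (\<tau> q)) \<and>
        snd (polygon_point n (\<tau> m)) \<le> snd (polygon_point n (\<tau> q))"
    and vertex: "\<And>m. m \<in> other_monomials n F \<Longrightarrow>
        (\<And>q. q \<in> other_monomials n F \<Longrightarrow>
          fst (polygon_point n m) \<le> fst (polygon_point n q) \<and>
          snd (polygon_point n m) \<le> snd (polygon_point n q)) \<Longrightarrow>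
        \<tau> m \<in> other_monomials n F1"
  shows "is_quadrant (hironaka_polygon n F1)"
proof (cases "other_monomials n F = {}")
  case True
  then have "other_monomials n F1 = {}" using lower by blast
  then show ?thesis using is_quadrant_hironaka_polygon_iff[of n F1] assms(2) by blast
next
  case False
  then obtain m where m: "m \<in> other_monomials n F"
    "\<And>q. q \<in> other_monomials n F \<Longrightarrow>
        fst (polygon_point n m) \<le> fst (polygon_point n q) \<and>
        snd (polygon_point n m) \<le> snd (polygon_point n q)"
    using is_quadrant_hironaka_polygon_iff[of n F] assms(1) quad by blast
  have "fst (polygon_point n (\<tau> m)) \<le> fst (polygon_point n q) \<and>
        snd (polygon_point n (\<tau> m)) \<le> snd (polygon_point n q)"
    if q: "q \<in> other_monomials n F1" for q
    using lower[OF q] m mono by (meson order_trans)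
  moreover have "\<tau> m \<in> other_monomials n F1" using vertex m by blast
  ultimately show ?thesis using is_quadrant_hironaka_polygon_iff[of n F1] assms(2) by blast
qed

theorem proposition2:
  fixes F F1 :: "'a::{alg_closed_field, field_char_0} series3" and n :: nat
  assumes "n > 1"
    and "ord3 F = enat n"
    and "WT_equation n F"
    and "initial_form F = varZ ^ n"
    and "is_quadrant (hironaka_polygon n F)"
    and "quadratic_transform n F F1"
    and "ord3 F1 = enat n"
    and "WT_equation n F1"
  shows "is_quadrant (hironaka_polygon n F1)"
proof -
  let ?M = "other_monomials n F" and ?M1 = "other_monomials n F1"
  have less: "k < n" if "(i, j, k) \<in> ?M" for i j k
    using WT_equation_other_monomials_less[OF assms(3) that] .
  have less1: "k < n" if "(i, j, k) \<in> ?M1" for i j k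
    using WT_equation_other_monomials_less[OF assms(8) that] .
  have deg: "n \<le> i + j + k" if "coeff3 F i j k \<noteq> 0" for i j k
    using ord3_le[OF that] assms(2) by simp
  have mem: "coeff3 F i j k \<noteq> 0" if "(i, j, k) \<in> ?M" for i j k
    using that by (simp add: other_monomials_def)
  have ratio: "real (i + j + k - n) / (real n - real k) =
      real i / (real n - real k) + real j / (real n - real k) - 1" if "(i, j, k) \<in> ?M" for i j k
  proof -
    have "real (i + j + k - n) = real i + real j - (real n - real k)"
      using deg[OF mem[OF that]] by simp
    then show ?thesis using less[OF that] by (simp add: diff_divide_distrib add_divide_distrib)
  qed
  consider (X) \<alpha> where "varX ^ n * F1 = subst3 F varX (varX * (varY + const3 \<alpha>)) (varX * varZ)"
    | (Y) "varY ^ n * F1 = subst3 F (varX * varY) varY (varY * varZ)"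
    using assms(6) unfolding quadratic_transform_def by blast
  then show ?thesis
  proof cases
    case (X \<alpha>)
    have coeff: "coeff3 F1 a b c =
        coeff3 (subst3 F varX (varX * (varY + const3 \<alpha>)) (varX * varZ)) (a + n) b c" for a b c
      by (simp add: coeff3_varX_power_mult flip: X)
    \<comment> \<open>\<open>e j\<close> is the order of \<open>(Y + \<alpha>)^j\<close>.\<close>
    define e where "e = (\<lambda>j::nat. if \<alpha> = 0 then j else 0)"
    have e_le: "e j \<le> b" if "fps_nth ((fps_X + fps_const \<alpha>) ^ j) b \<noteq> 0" for j b
      using that by (auto simp: e_def split: if_splits)
    have e_nz: "fps_nth ((fps_X + fps_const \<alpha>) ^ j) (e j) \<noteq> 0" for j
      by (simp add: e_def)
    define \<tau> where "\<tau> = (\<lambda>(i, j, k). (i + j + k - n, e j, k))"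
    show ?thesis
    proof (rule is_quadrant_transfer[where F = F and n = n and \<tau> = \<tau>])
      fix q assume q: "q \<in> ?M1"
      obtain a b c where abc: "q = (a, b, c)" by (cases q)
      then have nz: "coeff3 F1 a b c \<noteq> 0" and c: "c < n"
        using q less1 by (auto simp: other_monomials_def)
      obtain i j k where ijk: "coeff3 F i j k \<noteq> 0"
        "coeff3 (varX ^ i * (varX * (varY + const3 \<alpha>)) ^ j * (varX * varZ) ^ k) (a + n) b c \<noteq> 0"
        using nz unfolding coeff by (rule coeff3_subst3_nonzero)
      then have *: "a + n = i + j + k" "c = k" "fps_nth ((fps_X + fps_const \<alpha>) ^ j) b \<noteq> 0"
        by (auto simp: coeff3_product_direction_X split: if_splits)
      have "(i, j, k) \<in> ?M" using ijk * c by (auto simp: other_monomials_def)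
      moreover have "\<tau> (i, j, k) = (a, e j, c)" using * by (simp add: \<tau>_def)
      ultimately show "\<exists>m\<in>?M. fst (polygon_point n (\<tau> m)) \<le> fst (polygon_point n q) \<and>
          snd (polygon_point n (\<tau> m)) \<le> snd (polygon_point n q)"
        using e_le[OF *(3)] c abc by (intro bexI[of _ "(i, j, k)"]) (auto simp: divide_right_mono)
    next
      fix m q assume mq: "m \<in> ?M" "q \<in> ?M"
        "fst (polygon_point n m) \<le> fst (polygon_point n q)"
        "snd (polygon_point n m) \<le> snd (polygon_point n q)"
      obtain i j k i' j' k' where "m = (i, j, k)" "q = (i', j', k')" by (cases m, cases q)
      with mq show "fst (polygon_point n (\<tau> m)) \<le> fst (polygon_point n (\<tau> q)) \<and>
          snd (polygon_point n (\<tau> m)) \<le> snd (polygon_point n (\<tau> q))"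
        by (simp add: \<tau>_def ratio e_def)
    next
      fix m assume m: "m \<in> ?M" and min: "\<And>q. q \<in> ?M \<Longrightarrow>
          fst (polygon_point n m) \<le> fst (polygon_point n q) \<and>
          snd (polygon_point n m) \<le> snd (polygon_point n q)"
      obtain i j k where ijk: "m = (i, j, k)" by (cases m)
      have k: "k < n" and nz: "coeff3 F i j k \<noteq> 0" using m less mem ijk by auto
      have d: "i + j + k - n + n = i + j + k" using deg[OF nz] by simp
      have "coeff3 F1 (i + j + k - n) (e j) k = coeff3 F i j k *
          coeff3 (varX ^ i * (varX * (varY + const3 \<alpha>)) ^ j * (varX * varZ) ^ k) (i + j + k) (e j) k"
        unfolding coeff d
      proof (rule coeff3_subst3_single)
        fix i' j' k' assume nz': "coeff3 F i' j' k' \<noteq> 0" and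
          "coeff3 (varX ^ i' * (varX * (varY + const3 \<alpha>)) ^ j' * (varX * varZ) ^ k')
             (i + j + k) (e j) k \<noteq> 0"
        then have *: "i + j + k = i' + j' + k'" "k = k'"
          by (auto simp: coeff3_product_direction_X split: if_splits)
        then have "(i', j', k) \<in> ?M" using nz' k by (auto simp: other_monomials_def)
        \<comment> \<open>Since \<open>k' = k\<close>, the denominators agree and minimality compares the exponents.\<close>
        from min[OF this] have "i \<le> i'" "j \<le> j'" using k by (auto simp: ijk divide_le_cancel)
        then show "(i', j', k') = (i, j, k)" using * by simp
      qed auto
      also have "\<dots> \<noteq> 0" using nz e_nz by (simp add: coeff3_product_direction_X)
      finally show "\<tau> m \<in> ?M1" using k by (simp add: \<tau>_def ijk other_monomials_def)
    qed (use less less1 assms(5) in blast)+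
  next
    case Y
    have coeff: "coeff3 F1 a b c =
        coeff3 (subst3 F (varX * varY) varY (varY * varZ)) a (b + n) c" for a b c
      by (simp add: coeff3_varY_power_mult flip: Y)
    define \<tau> where "\<tau> = (\<lambda>(i, j, k). (i, i + j + k - n, k))"
    show ?thesis
    proof (rule is_quadrant_transfer[where F = F and n = n and \<tau> = \<tau>])
      fix q assume q: "q \<in> ?M1"
      obtain a b c where abc: "q = (a, b, c)" by (cases q)
      then have nz: "coeff3 F1 a b c \<noteq> 0" and c: "c < n"
        using q less1 by (auto simp: other_monomials_def)
      obtain i j k where ijk: "coeff3 F i j k \<noteq> 0"
        "coeff3 ((varX * varY) ^ i * varY ^ j * (varY * varZ) ^ k :: 'a series3) a (b + n) c \<noteq> 0"
        using nz unfolding coeff by (rule coeff3_subst3_nonzero)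
      then have *: "a = i" "b + n = i + j + k" "c = k"
        by (auto simp: coeff3_product_direction_Y split: if_splits)
      have "(i, j, k) \<in> ?M" using ijk * c by (auto simp: other_monomials_def)
      moreover have "\<tau> (i, j, k) = q" using * abc by (simp add: \<tau>_def flip: *(2))
      ultimately show "\<exists>m\<in>?M. fst (polygon_point n (\<tau> m)) \<le> fst (polygon_point n q) \<and>
          snd (polygon_point n (\<tau> m)) \<le> snd (polygon_point n q)" by force
    next
      fix m q assume mq: "m \<in> ?M" "q \<in> ?M"
        "fst (polygon_point n m) \<le> fst (polygon_point n q)"
        "snd (polygon_point n m) \<le> snd (polygon_point n q)"
      obtain i j k i' j' k' where "m = (i, j, k)" "q = (i', j', k')" by (cases m, cases q)
      with mq show "fst (polygon_point n (\<tau> m)) \<le> fst (polygon_point n (\<tau> q)) \<and>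
          snd (polygon_point n (\<tau> m)) \<le> snd (polygon_point n (\<tau> q))"
        by (simp add: \<tau>_def ratio)
    next
      fix m assume m: "m \<in> ?M"
      obtain i j k where ijk: "m = (i, j, k)" by (cases m)
      have k: "k < n" and nz: "coeff3 F i j k \<noteq> 0" using m less mem ijk by auto
      have d: "i + j + k - n + n = i + j + k" using deg[OF nz] by simp
      have "coeff3 F1 i (i + j + k - n) k = coeff3 F i j k *
          coeff3 ((varX * varY) ^ i * varY ^ j * (varY * varZ) ^ k :: 'a series3) i (i + j + k) k"
        unfolding coeff d
        by (rule coeff3_subst3_single) (auto simp: coeff3_product_direction_Y split: if_splits)
      also have "\<dots> \<noteq> 0" using nz by (simp add: coeff3_product_direction_Y)
      finally show "\<tau> m \<in> ?M1" using k by (simp add: \<tau>_def ijk other_monomials_def)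
    qed (use less less1 assms(5) in blast)+
  qed
qed

end
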